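(* Let $p$ be an odd prime and let $\chi$ be the quadratic character modulo $p$ on $\mathbb F_p$. For $(\varepsilon_1,\varepsilon_2)\in\{\pm1\}^2$ define \[ N(\varepsilon_1,\varepsilon_2)=\#\{n\in\mathbb F_p:\ \chi(n)=\varepsilon_1,\ \chi(n+1)=\varepsilon_2\}. \] Then for every $(\varepsilon_1,\varepsilon_2)\in\{\pm1\}^2$, \[ N(\varepsilon_1,\varepsilon_2)=\frac14 \begin{cases} p-2-(\varepsilon_2+\varepsilon_1+\varepsilon_1\varepsilon_2), & \text{if } p\equiv 1\pmod 4,\\[1mm] p-2-(\varepsilon_2-\varepsilon_1+\varepsilon_1\varepsilon_2), & \text{if } p\equiv 3\pmod 4. \end{cases} \] In particular, the distribution of pairs is symmetric, i.e. $N(\varepsilon_1,\varepsilon_2)=N(\varepsilon_2,\varepsilon_1)$ for all $(\varepsilon_1,\varepsilon_2)\in\{\pm1\}^2$, if and only if $p\equiv 1\pmod 4$.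
   Context: $\mathbb F_p=\mathbb Z/p\mathbb Z$. The quadratic character $\chi$ modulo $p$ (Legendre symbol) is the function $\chi:\mathbb F_p\to\{-1,0,1\}$ with $\chi(0)=0$, $\chi(x)=1$ if $x$ is a nonzero square in $\mathbb F_p$, and $\chi(x)=-1$ if $x$ is not a square in $\mathbb F_p$. *)

theory Defs
  imports Complex_Main "HOL-Number_Theory.Number_Theory"
begin

text \<open>
  The field with \<open>p\<close> elements is \<^const>\<open>residue_ring\<close>, with carrier \<open>{0..p - 1}\<close> and
  arithmetic modulo \<open>p\<close>; the quadratic character at \<open>n\<close> is \<^const>\<open>Legendre\<close> applied
  to the representative \<open>n\<close>.
\<close>

definition pair_count :: "nat \<Rightarrow> int \<Rightarrow> int \<Rightarrow> nat" where
  "pair_count p \<epsilon>1 \<epsilon>2 =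
     card {n \<in> carrier (residue_ring (int p)).
             Legendre n (int p) = \<epsilon>1 \<and>
             Legendre (n \<oplus>\<^bsub>residue_ring (int p)\<^esub> \<one>\<^bsub>residue_ring (int p)\<^esub>) (int p) = \<epsilon>2}"

end

theory Submission
  imports Defs
begin

text \<open>
  Off \<open>n = 0, -1\<close> the indicator of \<open>\<chi>(n) = \<epsilon>1 \<and> \<chi>(n + 1) = \<epsilon>2\<close> is
  \<open>(1 + \<epsilon>1 \<chi>(n)) (1 + \<epsilon>2 \<chi>(n + 1)) / 4\<close>. Expanding and summing, one needs the complete character
  sum \<open>\<Sum> \<chi>(n) = 0\<close> and the correlation \<open>\<Sum> \<chi>(n) \<chi>(n + 1) = \<Sum> \<chi>(1 + n\<inverse>) = -1\<close>; the missing
  points contribute \<open>\<chi>(1) = 1\<close> and \<open>\<chi>(-1) = (-1)^((p - 1)/2)\<close>.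
\<close>

section \<open>Congruence invariance and multiplicativity of the Legendre symbol\<close>

lemma Legendre_cong:
  assumes "[a = b] (mod m)"
  shows "Legendre a m = Legendre b m"
proof -
  have "[x = a] (mod m) \<longleftrightarrow> [x = b] (mod m)" for x
    using assms cong_sym cong_trans by blast
  moreover have "[a = 0] (mod m) \<longleftrightarrow> [b = 0] (mod m)"
    using assms cong_sym cong_trans by blast
  ultimately show ?thesis
    by (simp add: Legendre_def QuadRes_def)
qed

lemma Legendre_mod [simp]: "Legendre (a mod m) m = Legendre a m"
  by (rule Legendre_cong) (simp add: cong_def)

lemma Legendre_values: "Legendre a m \<in> {-1, 0, 1}"
  by (simp add: Legendre_def)

lemma Legendre_eq_0_iff: "Legendre a m = 0 \<longleftrightarrow> m dvd a"
  by (simp add: Legendre_def cong_0_iff)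

text \<open>Two elements of {-1, 0, 1} differ by at most 2, so a modulus above 2 divides their
  difference only if it is 0. This turns Euler's criterion, a congruence, into equations.\<close>

lemma Legendre_eqI:
  assumes "[Legendre a m = c] (mod m)" "c \<in> {-1, 0, 1}" "m > 2"
  shows "Legendre a m = c"
proof -
  have "m dvd Legendre a m - c"
    using assms(1) by (simp add: cong_iff_dvd_diff)
  moreover have "\<bar>Legendre a m - c\<bar> \<le> 2"
    using Legendre_values[of a m] assms(2) by auto
  ultimately show ?thesis
    using assms(3) zdvd_not_zless[of "\<bar>Legendre a m - c\<bar>" m] by force
qed

text \<open>By Euler's criterion the symbol is congruent to the power with exponent
  \<open>(p - 1) div 2\<close>, which is multiplicative.\<close>

lemma Legendre_mult:
  fixes p :: nat
  assumes "prime p" "p > 2"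
  shows "Legendre (a * b) (int p) = Legendre a (int p) * Legendre b (int p)"
proof (rule Legendre_eqI)
  let ?k = "(p - 1) div 2"
  have "[Legendre (a * b) (int p) = a ^ ?k * b ^ ?k] (mod int p)"
    using euler_criterion[OF assms, of "a * b"] by (simp add: power_mult_distrib)
  also have "[a ^ ?k * b ^ ?k = Legendre a (int p) * Legendre b (int p)] (mod int p)"
    by (intro cong_mult cong_sym[OF euler_criterion] assms)
  finally show "[Legendre (a * b) (int p) = Legendre a (int p) * Legendre b (int p)] (mod int p)" .
  show "Legendre a (int p) * Legendre b (int p) \<in> {-1, 0, 1}"
    using Legendre_values[of a "int p"] Legendre_values[of b "int p"] by auto
qed (use assms in auto)

lemma Legendre_minus_one:
  fixes p :: nat
  assumes "prime p" "p > 2"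
  shows "Legendre (-1) (int p) = (-1) ^ ((p - 1) div 2)"
  by (rule Legendre_eqI[OF euler_criterion])
     (use assms in \<open>auto simp: minus_one_power_iff\<close>)

lemma Legendre_square:
  fixes p :: nat
  assumes "prime p" "p > 2" "\<not> int p dvd a"
  shows "Legendre (a * a) (int p) = 1"
  using Legendre_values[of a "int p"] assms
  by (auto simp: Legendre_mult Legendre_eq_0_iff[symmetric])

section \<open>The complete character sum\<close>

lemma coprime_prime_range:
  fixes p :: nat
  assumes "prime p" "a \<in> {1..<int p}"
  shows "coprime a (int p)"
  using assms prime_imp_coprime_int[of "int p" a] zdvd_not_zless[of a "int p"]
  by (auto simp: coprime_commute)

text \<open>Squaring identifies \<open>1\<close> and \<open>-1\<close>, so on a finite set it cannot be surjective.\<close>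
lemma ex_Legendre_eq_minus_one:
  fixes p :: nat
  assumes "prime p" "p > 2"
  obtains a where "a \<in> {1..<int p}" "Legendre a (int p) = -1"
proof -
  let ?A = "{1..<int p}"
  let ?f = "\<lambda>y. y\<^sup>2 mod int p"
  have "(int p - 1)\<^sup>2 mod int p = 1\<^sup>2 mod int p"
    by (simp add: power2_eq_square algebra_simps mod_diff_eq flip: mod_diff_eq)
  hence "\<not> inj_on ?f ?A"
    using assms(2) inj_onD[of ?f ?A "int p - 1" 1] by auto
  hence "\<not> ?A \<subseteq> ?f ` ?A"
    using finite_surj_inj[of ?A ?f] by auto
  then obtain a where a: "a \<in> ?A" "a \<notin> ?f ` ?A"
    by blast
  have "\<not> QuadRes (int p) a"
  proof
    assume "QuadRes (int p) a"
    then obtain y where "[y\<^sup>2 = a] (mod int p)"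
      by (auto simp: QuadRes_def)
    hence y: "?f (y mod int p) = a"
      using a(1) by (simp add: cong_def power_mod)
    moreover have "y mod int p \<noteq> 0"
      using y a(1) by auto
    moreover have "0 \<le> y mod int p" "y mod int p < int p"
      using assms by auto
    ultimately have "a \<in> ?f ` ?A"
      by (intro image_eqI[of _ _ "y mod int p"]) auto
    thus False
      using a(2) by blast
  qed
  moreover have "\<not> int p dvd a"
    using a(1) zdvd_not_zless by auto
  ultimately have "Legendre a (int p) = -1"
    by (simp add: Legendre_def cong_0_iff)
  thus ?thesis
    using that a(1) by blast
qed

text \<open>Multiplication by a non-residue permutes the nonzero residues and flips the sign of
  every term, so the sum equals its own negative.\<close>

lemma sum_Legendre:
  fixes p :: nat
  assumes "prime p" "p > 2"
  shows "(\<Sum>n\<in>{1..<int p}. Legendre n (int p)) = 0"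
proof -
  obtain a where a: "a \<in> {1..<int p}" "Legendre a (int p) = -1"
    using ex_Legendre_eq_minus_one[OF assms] .
  have "(\<Sum>n\<in>{1..<int p}. Legendre n (int p)) = (\<Sum>n\<in>{1..<int p}. Legendre (a * n mod int p) (int p))"
    by (rule sum.reindex_bij_betw[symmetric] bij_betw_int_remainders_mult
          coprime_prime_range assms a)+
  also have "\<dots> = - (\<Sum>n\<in>{1..<int p}. Legendre n (int p))"
    by (simp add: Legendre_mult[OF assms] a(2) sum_negf)
  finally show ?thesis
    by simp
qed

section \<open>Modular inversion and the correlation sum\<close>

lemma modular_inverse_in_range:
  fixes p :: nat
  assumes "prime p" "a \<in> {1..<int p}"
  shows "modular_inverse (int p) a \<in> {1..<int p}"
  using mult_modular_inverse_int_pos[of "int p" a] modular_inverse_int_less[of "int p" a]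
    coprime_prime_range[OF assms] assms by force

text \<open>Inversion is an involution on the nonzero residues, so it serves as its own two-sided
  inverse map.\<close>

lemma bij_betw_modular_inverse:
  fixes p :: nat
  assumes "prime p"
  shows "bij_betw (modular_inverse (int p)) {1..<int p} {1..<int p}"
proof (rule bij_betw_byWitness[where f' = "modular_inverse (int p)"])
  have "modular_inverse (int p) (modular_inverse (int p) a) = a" if "a \<in> {1..<int p}" for a
    using that cong_modular_inverse2[OF coprime_prime_range[OF assms that]]
    by (intro modular_inverse_int_eqI) auto
  thus "\<forall>a\<in>{1..<int p}. modular_inverse (int p) (modular_inverse (int p) a) = a"
    "\<forall>a\<in>{1..<int p}. modular_inverse (int p) (modular_inverse (int p) a) = a"
    by auto
qed (use modular_inverse_in_range[OF assms] in auto)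

text \<open>\<open>\<chi>(n) \<chi>(n + 1) = \<chi>(n\<^sup>2) \<chi>(1 + n\<inverse>) = \<chi>(1 + n\<inverse>)\<close>.\<close>
lemma Legendre_mult_succ:
  fixes p :: nat
  assumes "prime p" "p > 2" "n \<in> {1..<int p}"
  shows "Legendre n (int p) * Legendre (n + 1) (int p) = Legendre (modular_inverse (int p) n + 1) (int p)"
proof -
  let ?i = "modular_inverse (int p) n"
  \<comment> \<open>The factor 1 is written out so that it can be replaced by \<open>n * ?i\<close>,
    which makes \<open>n * n\<close> a common factor.\<close>
  have "[n * n + n * 1 = n * n + n * (n * ?i)] (mod int p)"
    using cong_modular_inverse1[OF coprime_prime_range[OF assms(1,3)]]
    by (intro cong_add cong_mult cong_refl) (rule cong_sym)
  hence "[n * (n + 1) = n * n * (?i + 1)] (mod int p)"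
    by (simp add: algebra_simps)
  hence "Legendre (n * (n + 1)) (int p) = Legendre (n * n * (?i + 1)) (int p)"
    by (rule Legendre_cong)
  moreover have "\<not> int p dvd n"
    using assms(3) zdvd_not_zless by auto
  ultimately show ?thesis
    using Legendre_square[OF assms(1,2)] by (metis Legendre_mult[OF assms(1,2)] mult_1)
qed

lemma Legendre_one:
  assumes "m > (2 :: int)"
  shows "Legendre 1 m = 1"
  using assms zdvd_not_zless[of 1 m] by (auto simp: Legendre_def QuadRes_def cong_0_iff intro: exI[of _ 1])

text \<open>The shift moves the range to 2, ..., p: compared with the complete sum, which is 0, the
  term \<chi>(1) = 1 is lost and \<chi>(p) = 0 is gained.\<close>

lemma sum_Legendre_succ:
  fixes p :: nat
  assumes "prime p" "p > 2"
  shows "(\<Sum>n\<in>{1..<int p}. Legendre (n + 1) (int p)) = -1"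
proof -
  have "(\<Sum>n\<in>{1..<int p}. Legendre (n + 1) (int p)) = (\<Sum>n\<in>{2..<int p + 1}. Legendre n (int p))"
    by (rule sum.reindex_bij_witness[of _ "\<lambda>n. n - 1" "\<lambda>n. n + 1"]) auto
  also have "{2..<int p + 1} = insert (int p) ({1..<int p} - {1})"
    using assms(2) by auto
  also have "(\<Sum>n\<in>\<dots>. Legendre n (int p)) = -1"
    using assms Legendre_eq_0_iff[of "int p" "int p"]
    by (simp add: sum_diff1 sum_Legendre Legendre_one)
  finally show ?thesis .
qed

text \<open>After rewriting each product as \<chi>(1 + 1/n), the substitution of 1/n for n reduces
  the correlation to the shifted sum.\<close>

lemma sum_Legendre_mult_succ:
  fixes p :: nat
  assumes "prime p" "p > 2"
  shows "(\<Sum>n\<in>{1..<int p}. Legendre n (int p) * Legendre (n + 1) (int p)) = -1"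
proof -
  have "(\<Sum>n\<in>{1..<int p}. Legendre n (int p) * Legendre (n + 1) (int p)) =
        (\<Sum>n\<in>{1..<int p}. Legendre (modular_inverse (int p) n + 1) (int p))"
    by (intro sum.cong Legendre_mult_succ assms refl)
  also have "\<dots> = (\<Sum>n\<in>{1..<int p}. Legendre (n + 1) (int p))"
    by (rule sum.reindex_bij_betw[OF bij_betw_modular_inverse[OF assms(1)]])
  finally show ?thesis
    by (simp add: sum_Legendre_succ[OF assms])
qed

section \<open>Counting the pairs\<close>

text \<open>Nonzero signs exclude \<open>n = 0\<close> and \<open>n = p - 1\<close>, where \<chi>(n)
  or \<chi>(n + 1) vanishes. Addition in the ring becomes integer addition because the symbol
  ignores reduction modulo \<open>p\<close>.\<close>

lemma pair_count_eq_card: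
  fixes p :: nat
  assumes "p > 2" "\<epsilon>1 \<noteq> 0" "\<epsilon>2 \<noteq> 0"
  shows "pair_count p \<epsilon>1 \<epsilon>2 =
    card {n \<in> {1..<int p - 1}. Legendre n (int p) = \<epsilon>1 \<and> Legendre (n + 1) (int p) = \<epsilon>2}"
proof -
  have "n \<in> {1..<int p - 1}"
    if "n \<in> {0..int p - 1}" "Legendre n (int p) = \<epsilon>1" "Legendre (n + 1) (int p) = \<epsilon>2" for n
    using that assms Legendre_eq_0_iff[of n "int p"] Legendre_eq_0_iff[of "n + 1" "int p"]
    by (cases "n = 0"; cases "n = int p - 1") auto
  thus ?thesis
    unfolding pair_count_def residue_ring_def
    using assms(1) by (auto intro!: arg_cong[where f = card])
qed

text \<open>Keeping \<chi>(-1) as a parameter treats both classes of \<open>p\<close> modulo 4 at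
  once, and the factor 4 keeps the computation in the integers.\<close>

lemma four_pair_count:
  fixes p :: nat
  assumes p: "prime p" "p > 2" and \<epsilon>: "\<epsilon>1 \<in> {-1, 1}" "\<epsilon>2 \<in> {-1, 1}"
  shows "4 * int (pair_count p \<epsilon>1 \<epsilon>2) = int p - 2 - (\<epsilon>2 + \<epsilon>1 * Legendre (-1) (int p) + \<epsilon>1 * \<epsilon>2)"
proof -
  let ?\<chi> = "\<lambda>n. Legendre n (int p)"
  let ?A = "{1..<int p - 1}"
  have A: "{1..<int p} = insert (int p - 1) ?A"
    using p(2) by auto
  have [simp]: "?\<chi> (int p) = 0"
    by (simp add: Legendre_eq_0_iff)
  have [simp]: "?\<chi> (int p - 1) = ?\<chi> (-1)"
    by (rule Legendre_cong) (simp add: cong_iff_dvd_diff)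
  \<comment> \<open>The complete sums also contain \<open>n = p - 1\<close>. Dropping it removes
    \<chi>(-1) from the first sum but nothing from the other two, since \<chi>(p) = 0.\<close>
  have sum1: "(\<Sum>n\<in>?A. ?\<chi> n) = - ?\<chi> (-1)"
    using sum_Legendre[OF p] by (simp add: A)
  have sum2: "(\<Sum>n\<in>?A. ?\<chi> (n + 1)) = -1"
    using sum_Legendre_succ[OF p] by (simp add: A)
  have sum12: "(\<Sum>n\<in>?A. ?\<chi> n * ?\<chi> (n + 1)) = -1"
    using sum_Legendre_mult_succ[OF p] by (simp add: A)
  have indicator: "4 * of_bool (?\<chi> n = \<epsilon>1 \<and> ?\<chi> (n + 1) = \<epsilon>2) =
      1 + \<epsilon>1 * ?\<chi> n + \<epsilon>2 * ?\<chi> (n + 1) + \<epsilon>1 * \<epsilon>2 * (?\<chi> n * ?\<chi> (n + 1))" if n: "n \<in> ?A" for n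
  proof -
    \<comment> \<open>Both values must be signs here: where one of them vanishes, the product
      formula can differ from the indicator.\<close>
    have "?\<chi> n \<noteq> 0" "?\<chi> (n + 1) \<noteq> 0"
      using n zdvd_not_zless[of n "int p"] zdvd_not_zless[of "n + 1" "int p"]
      by (auto simp: Legendre_eq_0_iff)
    hence "?\<chi> n = -1 \<or> ?\<chi> n = 1" "?\<chi> (n + 1) = -1 \<or> ?\<chi> (n + 1) = 1"
      using Legendre_values[of n "int p"] Legendre_values[of "n + 1" "int p"] by auto
    thus ?thesis
      using \<epsilon> by auto
  qed
  have "4 * int (pair_count p \<epsilon>1 \<epsilon>2) = (\<Sum>n\<in>?A. 4 * of_bool (?\<chi> n = \<epsilon>1 \<and> ?\<chi> (n + 1) = \<epsilon>2))"
    using pair_count_eq_card[of p \<epsilon>1 \<epsilon>2] p \<epsilon>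
    by (auto simp: sum_distrib_left[symmetric] sum_of_bool_eq Int_def)
  also have "\<dots> = (\<Sum>n\<in>?A. 1 + \<epsilon>1 * ?\<chi> n + \<epsilon>2 * ?\<chi> (n + 1) + \<epsilon>1 * \<epsilon>2 * (?\<chi> n * ?\<chi> (n + 1)))"
    by (rule sum.cong[OF refl indicator])
  \<comment> \<open>The main term \<open>int p - 2\<close> is the number of elements of
    \<open>?A\<close>.\<close>
  also have "\<dots> = int p - 2 - (\<epsilon>2 + \<epsilon>1 * ?\<chi> (-1) + \<epsilon>1 * \<epsilon>2)"
    using p(2) by (simp add: sum.distrib sum_distrib_left[symmetric] sum1 sum2 sum12)
  finally show ?thesis .
qed

theorem theorem4:
  fixes p :: nat
  assumes "prime p" and "odd p"
  shows "(\<forall>\<epsilon>1 \<in> {-1, 1 :: int}. \<forall>\<epsilon>2 \<in> {-1, 1 :: int}.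
            ([p = 1] (mod 4) \<longrightarrow>
               real (pair_count p \<epsilon>1 \<epsilon>2) =
                 1 / 4 * (real p - 2 - real_of_int (\<epsilon>2 + \<epsilon>1 + \<epsilon>1 * \<epsilon>2))) \<and>
            ([p = 3] (mod 4) \<longrightarrow>
               real (pair_count p \<epsilon>1 \<epsilon>2) =
                 1 / 4 * (real p - 2 - real_of_int (\<epsilon>2 - \<epsilon>1 + \<epsilon>1 * \<epsilon>2)))) \<and>
         ((\<forall>\<epsilon>1 \<in> {-1, 1 :: int}. \<forall>\<epsilon>2 \<in> {-1, 1 :: int}.
             pair_count p \<epsilon>1 \<epsilon>2 = pair_count p \<epsilon>2 \<epsilon>1) \<longleftrightarrow> [p = 1] (mod 4))"
proof -
  have p: "prime p" "p > 2"
    using assms prime_ge_2_nat[of p] by (cases "p = 2"; simp)+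
  have one: "Legendre (-1) (int p) = 1" if "[p = 1] (mod 4)"
  proof -
    have "even ((p - 1) div 2)"
      using that by (auto simp: cong_def) presburger
    thus ?thesis
      by (simp add: Legendre_minus_one[OF p])
  qed
  have three: "Legendre (-1) (int p) = -1" if "[p = 3] (mod 4)"
  proof -
    have "odd ((p - 1) div 2)"
      using that by (auto simp: cong_def) presburger
    thus ?thesis
      by (simp add: Legendre_minus_one[OF p])
  qed
  have formula: "real (pair_count p \<epsilon>1 \<epsilon>2) =
      1 / 4 * (real p - 2 - real_of_int (\<epsilon>2 + \<epsilon>1 * Legendre (-1) (int p) + \<epsilon>1 * \<epsilon>2))"
    if "\<epsilon>1 \<in> {-1, 1}" "\<epsilon>2 \<in> {-1, 1}" for \<epsilon>1 \<epsilon>2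
    using arg_cong[OF four_pair_count[OF p that], of real_of_int] by simp
  have cases: "[p = 1] (mod 4) \<or> [p = 3] (mod 4)"
    using assms(2) unfolding cong_def by simp presburger
  \<comment> \<open>When \<chi>(-1) = -1, the part \<epsilon>2 - \<epsilon>1 changes sign under the
    swap. For the signs 1 and -1 the two counts are (p + 1)/4 and (p - 3)/4, which differ by
    1.\<close>
  have "\<not> [p = 1] (mod 4) \<Longrightarrow> pair_count p 1 (-1) \<noteq> pair_count p (-1) 1"
    using cases three formula[of 1 "-1"] formula[of "-1" 1] by auto
  \<comment> \<open>With \<chi>(-1) = 1 the formula is symmetric in the two signs.\<close>
  moreover have "pair_count p \<epsilon>1 \<epsilon>2 = pair_count p \<epsilon>2 \<epsilon>1"
    if "[p = 1] (mod 4)" "\<epsilon>1 \<in> {-1, 1}" "\<epsilon>2 \<in> {-1, 1}" for \<epsilon>1 \<epsilon>2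
    using four_pair_count[OF p that(2,3)] four_pair_count[OF p that(3,2)] one[OF that(1)]
    by (simp add: algebra_simps)
  ultimately have symmetric: "(\<forall>\<epsilon>1 \<in> {-1, 1 :: int}. \<forall>\<epsilon>2 \<in> {-1, 1 :: int}.
      pair_count p \<epsilon>1 \<epsilon>2 = pair_count p \<epsilon>2 \<epsilon>1) \<longleftrightarrow> [p = 1] (mod 4)"
    by blast
  show ?thesis
    by (intro conjI ballI impI symmetric) (simp_all only: formula one three, simp_all)
qed

end
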